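(* Let $S_1,\dots,S_n$ be numerical semigroups and let $F=\max\{F(S_1),\dots,F(S_n)\}$. Let $\langle\{S_1,\dots,S_n\}\rangle$ denote the intersection of all covarieties that contain $\{S_1,\dots,S_n\}$ and have $\{0\}\cup\{z\in\mathbb{N}\mid z\geq F+1\}$ as minimum. Then $\langle\{S_1,\dots,S_n\}\rangle$ is the smallest (with respect to set inclusion) covariety that contains $\{S_1,\dots,S_n\}$ and has $\{0\}\cup\{z\in\mathbb{N}\mid z\geq F+1\}$ as minimum.
   Context: Let $\mathbb{N}=\{0,1,2,\dots\}$. A numerical semigroup is a subset $S\subseteq\mathbb{N}$ that contains $0$, is closed under addition, and has finite complement $\mathbb{N}\setminus S$. Its multiplicity is $m(S)=\min(S\setminus\{0\})$ and its Frobenius number is $F(S)=\max\{z\in\mathbb{Z}\mid z\notin S\}$. A covariety is a nonempty family $\mathcal{C}$ of numerical semigroups such that: (1) $\mathcal{C}$ has a minimum $\Delta(\mathcal{C})=\min(\mathcal{C})$ with respect to set inclusion; (2) if $S,T\in\mathcal{C}$ then $S\cap T\in\mathcal{C}$; (3) if $S\in\mathcal{C}$ and $S\neq\Delta(\mathcal{C})$ then $S\setminus\{m(S)\}\in\mathcal{C}$. *)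

theory Defs
  imports Main
begin

definition is_minimum :: "'a::order set \<Rightarrow> 'a \<Rightarrow> bool" where
  "is_minimum A x \<longleftrightarrow> x \<in> A \<and> (\<forall>y\<in>A. x \<le> y)"

definition numerical_semigroup :: "nat set \<Rightarrow> bool" where
  "numerical_semigroup S \<longleftrightarrow> 0 \<in> S \<and> (\<forall>x\<in>S. \<forall>y\<in>S. x + y \<in> S) \<and> finite (UNIV - S)"

definition multiplicity :: "nat set \<Rightarrow> nat" where
  "multiplicity S = (LEAST x. x \<in> S - {0})"

(* The maximum ranges over all integers not in S, so the value is -1 for S = UNIV. *)
definition frobenius :: "nat set \<Rightarrow> int" where
  "frobenius S = (GREATEST z. z \<notin> int ` S)"

(* The order on nat set is inclusion; the value is meaningful only if the family has a minimum. *)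
definition Delta :: "nat set set \<Rightarrow> nat set" where
  "Delta \<C> = (LEAST D. D \<in> \<C>)"

definition covariety :: "nat set set \<Rightarrow> bool" where
  "covariety \<C> \<longleftrightarrow>
     \<C> \<noteq> {} \<and>
     (\<forall>S\<in>\<C>. numerical_semigroup S) \<and>
     (\<exists>D. is_minimum \<C> D) \<and>
     (\<forall>S\<in>\<C>. \<forall>T\<in>\<C>. S \<inter> T \<in> \<C>) \<and>
     (\<forall>S\<in>\<C>. S \<noteq> Delta \<C> \<longrightarrow> S - {multiplicity S} \<in> \<C>)"

definition ordinary_semigroup :: "int \<Rightarrow> nat set" where
  "ordinary_semigroup F = {0} \<union> {z. int z \<ge> F + 1}"

definition covarieties_containing :: "nat set set \<Rightarrow> int \<Rightarrow> nat set set set" where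
  "covarieties_containing X F =
     {\<C>. covariety \<C> \<and> X \<subseteq> \<C> \<and> is_minimum \<C> (ordinary_semigroup F)}"

definition generated_covariety :: "nat set set \<Rightarrow> nat set set" where
  "generated_covariety X = \<Inter> (covarieties_containing X (Max (frobenius ` X)))"

end

theory Submission
  imports Defs
begin

text \<open>A minimum of a family is unique, so all covarieties with minimum \<open>D\<close> use the same exceptional
  semigroup \<open>D\<close> in condition (3). Hence the conditions pass to intersections, and what has to be shown
  is that at least one admissible covariety exists. The numerical semigroups containing
  \<open>{0} \<union> {z. z \<ge> F + 1}\<close> form one: such a semigroup other than the minimum has
  its multiplicity at most \<open>F\<close>, so that removing the multiplicity keeps the minimum inside.\<close>

lemma Delta_eq:
  assumes "is_minimum \<C> D"
  shows "Delta \<C> = D"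
  using assms unfolding Delta_def is_minimum_def by (intro Least_equality) auto

text \<open>With \<open>D\<close> in place of \<open>Delta\<close>, the exception in condition (3)
  no longer depends on the family, so the condition can be compared across covarieties.\<close>

lemma covariety_iff:
  assumes "is_minimum \<C> D"
  shows "covariety \<C> \<longleftrightarrow>
    (\<forall>S\<in>\<C>. numerical_semigroup S) \<and> (\<forall>S\<in>\<C>. \<forall>T\<in>\<C>. S \<inter> T \<in> \<C>) \<and>
    (\<forall>S\<in>\<C>. S \<noteq> D \<longrightarrow> S - {multiplicity S} \<in> \<C>)"
  using assms Delta_eq[OF assms] unfolding covariety_def is_minimum_def by auto

lemma is_minimum_Inter:
  assumes "\<A> \<noteq> {}" and "\<And>\<C>. \<C> \<in> \<A> \<Longrightarrow> is_minimum \<C> D"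
  shows "is_minimum (\<Inter>\<A>) D"
  using assms unfolding is_minimum_def by blast

lemma covariety_Inter:
  assumes "\<A> \<noteq> {}"
    and "\<And>\<C>. \<C> \<in> \<A> \<Longrightarrow> covariety \<C>"
    and "\<And>\<C>. \<C> \<in> \<A> \<Longrightarrow> is_minimum \<C> D"
  shows "covariety (\<Inter>\<A>)"
proof -
  have \<A>: "(\<forall>S\<in>\<C>. numerical_semigroup S) \<and> (\<forall>S\<in>\<C>. \<forall>T\<in>\<C>. S \<inter> T \<in> \<C>) \<and>
      (\<forall>S\<in>\<C>. S \<noteq> D \<longrightarrow> S - {multiplicity S} \<in> \<C>)" if "\<C> \<in> \<A>" for \<C>
    using assms(2)[OF that] covariety_iff[OF assms(3)[OF that]] by simp
  have min: "is_minimum (\<Inter>\<A>) D"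
    using assms(1,3) by (rule is_minimum_Inter)
  \<comment> \<open>Elements of the intersection are numerical semigroups because they lie in some
    member of \<open>\<A>\<close>; an empty intersection would contain every set.\<close>
  obtain \<C> where "\<C> \<in> \<A>"
    using assms(1) by blast
  then have "\<forall>S\<in>\<Inter>\<A>. numerical_semigroup S"
    using \<A> by blast
  moreover have "\<forall>S\<in>\<Inter>\<A>. \<forall>T\<in>\<Inter>\<A>. S \<inter> T \<in> \<Inter>\<A>"
    using \<A> by (metis InterE InterI)
  moreover have "\<forall>S\<in>\<Inter>\<A>. S \<noteq> D \<longrightarrow> S - {multiplicity S} \<in> \<Inter>\<A>"
    using \<A> by (metis InterE InterI)
  ultimately show ?thesis
    using covariety_iff[OF min] by blast
qed

lemma numerical_semigroup_Int:
  assumes "numerical_semigroup S" and "numerical_semigroup T"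
  shows "numerical_semigroup (S \<inter> T)"
  using assms unfolding numerical_semigroup_def by (auto simp: Diff_Int)

lemma multiplicity_le:
  assumes "x \<in> S" and "x \<noteq> 0"
  shows "multiplicity S \<le> x"
  using assms unfolding multiplicity_def by (intro Least_le) auto

lemma multiplicity_neq_0:
  assumes "x \<in> S" and "x \<noteq> 0"
  shows "multiplicity S \<noteq> 0"
  using LeastI[of "\<lambda>x. x \<in> S - {0}" x] assms unfolding multiplicity_def by auto

text \<open>The multiplicity is not a sum of two other elements: two nonzero summands are each at
  least the multiplicity, which is positive, so their sum exceeds it. The element \<open>x\<close>
  ensures that the \<open>LEAST\<close> in \<open>multiplicity\<close> is attained.\<close>

lemma numerical_semigroup_remove_multiplicity:
  assumes S: "numerical_semigroup S" and x: "x \<in> S" "x \<noteq> 0"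
  shows "numerical_semigroup (S - {multiplicity S})"
proof -
  have "a + b \<noteq> multiplicity S"
    if "a \<in> S - {multiplicity S}" "b \<in> S - {multiplicity S}" for a b
    using that multiplicity_le[of a S] multiplicity_le[of b S] multiplicity_neq_0[OF x]
    by (cases "a = 0"; cases "b = 0") auto
  moreover have "UNIV - (S - {multiplicity S}) \<subseteq> insert (multiplicity S) (UNIV - S)"
    by blast
  ultimately show ?thesis
    using S multiplicity_neq_0[OF x] unfolding numerical_semigroup_def
    by (auto intro: finite_subset)
qed

lemma numerical_semigroup_ordinary: "numerical_semigroup (ordinary_semigroup F)"
proof -
  \<comment> \<open>For negative \<open>F\<close> there is no gap at all, so truncation by
    \<open>nat\<close> does no harm.\<close>
  have "UNIV - ordinary_semigroup F \<subseteq> {..nat F}"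
    unfolding ordinary_semigroup_def by auto
  then show ?thesis
    unfolding numerical_semigroup_def
    by (auto simp: ordinary_semigroup_def intro: finite_subset)
qed

lemma frobenius_ge:
  assumes "numerical_semigroup S" and "z \<notin> int ` S"
  shows "z \<le> frobenius S"
proof -
  \<comment> \<open>The negative integers are all gaps; adjoining only -1 keeps the set finite and nonempty,
    with the same greatest element.\<close>
  define G where "G = insert (-1) (int ` (UNIV - S))"
  have fin: "finite G"
    using assms(1) unfolding G_def numerical_semigroup_def by simp
  have gap: "w \<le> Max G" if "w \<notin> int ` S" for w
  proof (cases "w < 0")
    case True
    then have "w \<le> -1" by simp
    also have "-1 \<le> Max G" using fin by (intro Max_ge) (auto simp: G_def)
    finally show ?thesis .
  next
    case False
    then have "w = int (nat w)" by simp
    then have "w \<in> G"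
      using that unfolding G_def by (metis DiffI UNIV_I imageI insertI2)
    then show ?thesis using fin by simp
  qed
  have "Max G \<in> G"
    using fin by (intro Max_in) (auto simp: G_def)
  then have "Max G \<notin> int ` S"
    unfolding G_def by auto
  then have "frobenius S = Max G"
    unfolding frobenius_def using gap by (intro Greatest_equality)
  then show ?thesis
    using gap[OF assms(2)] by simp
qed

lemma ordinary_semigroup_subset:
  assumes "numerical_semigroup S" and "frobenius S \<le> F"
  shows "ordinary_semigroup F \<subseteq> S"
proof
  fix z
  assume z: "z \<in> ordinary_semigroup F"
  show "z \<in> S"
  proof (cases "z = 0")
    \<comment> \<open>Zero needs its own case, since it may lie below the Frobenius number.\<close>
    case True
    then show ?thesis using assms(1) by (simp add: numerical_semigroup_def)
  next
    case False
    then have "int z > frobenius S"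
      using z assms(2) by (simp add: ordinary_semigroup_def)
    then have "int z \<in> int ` S"
      using frobenius_ge[OF assms(1), of "int z"] by force
    then show ?thesis by auto
  qed
qed

text \<open>This family is the largest candidate: any covariety with this minimum is contained in
  it.\<close>

lemma is_minimum_semigroups_above_ordinary:
  "is_minimum {T. numerical_semigroup T \<and> ordinary_semigroup F \<subseteq> T} (ordinary_semigroup F)"
  using numerical_semigroup_ordinary unfolding is_minimum_def by blast

lemma covariety_semigroups_above_ordinary:
  "covariety {T. numerical_semigroup T \<and> ordinary_semigroup F \<subseteq> T}"
proof -
  have "numerical_semigroup (T - {multiplicity T}) \<and> ordinary_semigroup F \<subseteq> T - {multiplicity T}"
    if T: "numerical_semigroup T" "ordinary_semigroup F \<subseteq> T" "T \<noteq> ordinary_semigroup F" for T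
  proof -
    \<comment> \<open>The inclusion is proper. Such an \<open>x\<close> lies between 1 and
      \<open>F\<close>, and it bounds the multiplicity of \<open>T\<close> from above.\<close>
    obtain x where x: "x \<in> T" "x \<notin> ordinary_semigroup F"
      using T by blast
    then have x0: "x \<noteq> 0" and "int x \<le> F"
      by (auto simp: ordinary_semigroup_def)
    then have "multiplicity T \<notin> ordinary_semigroup F"
      using multiplicity_le[OF x(1) x0] multiplicity_neq_0[OF x(1) x0]
      by (auto simp: ordinary_semigroup_def)
    then show ?thesis
      using numerical_semigroup_remove_multiplicity[OF T(1) x(1) x0] T(2) by blast
  qed
  then show ?thesis
    using covariety_iff[OF is_minimum_semigroups_above_ordinary] numerical_semigroup_Int by auto
qed

text \<open>An intersection is always a lower bound; the content is that it is itself one of the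
  admissible covarieties.\<close>

lemma is_minimum_covarieties_containing:
  assumes "covarieties_containing X F \<noteq> {}"
  shows "is_minimum (covarieties_containing X F) (\<Inter>(covarieties_containing X F))"
proof -
  let ?\<A> = "covarieties_containing X F"
  have \<A>: "covariety \<C>" "is_minimum \<C> (ordinary_semigroup F)" "X \<subseteq> \<C>" if "\<C> \<in> ?\<A>" for \<C>
    using that unfolding covarieties_containing_def by auto
  have "covariety (\<Inter>?\<A>)" "is_minimum (\<Inter>?\<A>) (ordinary_semigroup F)"
    using covariety_Inter[OF assms \<A>(1,2)] is_minimum_Inter[OF assms \<A>(2)] by auto
  moreover have "X \<subseteq> \<Inter>?\<A>"
    using \<A>(3) by blast
  ultimately have "\<Inter>?\<A> \<in> ?\<A>"
    by (simp add: covarieties_containing_def)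
  then show ?thesis
    unfolding is_minimum_def by blast
qed

theorem proposition5p4:
  fixes S :: "nat \<Rightarrow> nat set" and n :: nat and F :: int
  assumes "n \<ge> 1"
    and "\<And>i. i \<in> {1..n} \<Longrightarrow> numerical_semigroup (S i)"
    and "F = Max ((\<lambda>i. frobenius (S i)) ` {1..n})"
  shows "is_minimum (covarieties_containing (S ` {1..n}) F) (generated_covariety (S ` {1..n}))"
proof -
  have "frobenius (S i) \<le> F" if "i \<in> {1..n}" for i
    using that unfolding assms(3) by (intro Max_ge) auto
  then have "S ` {1..n} \<subseteq> {T. numerical_semigroup T \<and> ordinary_semigroup F \<subseteq> T}"
    using assms(2) ordinary_semigroup_subset by blast
  \<comment> \<open>This witness supplies the nonemptiness on which the intersection argument
    rests.\<close>
  then have "{T. numerical_semigroup T \<and> ordinary_semigroup F \<subseteq> T}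
      \<in> covarieties_containing (S ` {1..n}) F"
    using covariety_semigroups_above_ordinary is_minimum_semigroups_above_ordinary
    unfolding covarieties_containing_def by blast
  moreover have "generated_covariety (S ` {1..n}) = \<Inter>(covarieties_containing (S ` {1..n}) F)"
    unfolding generated_covariety_def assms(3) by (simp add: image_image)
  ultimately show ?thesis
    using is_minimum_covarieties_containing by (metis empty_iff)
qed

end
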